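(* Let $\sigma = 7$ and $\beta = 1/\sqrt{2}$, and consider the control system with state $(R,\phi,\psi)$, $R\ge 0$, and scalar control input $u$, $$ \begin{aligned} \dot R &= -\sigma R^2 - \sigma R\,(2\phi + \phi^2),\\ \dot \phi &= -\psi - \tfrac{3}{2}\phi^2 - \tfrac{1}{2}\phi^3 - 3R\phi - 3R,\\ \dot \psi &= -\tfrac{1}{\beta^2}\,(u - \phi). \end{aligned} $$ Let $C$ be a real number and let $k_1, k_2$ be positive real numbers satisfying the inequalities $$ k_1 > \frac{17}{8} + \frac{(2C\sigma + 3)^2}{2}, $$ $$ \left(C\sigma - \frac{105}{64}\right)k_1^2 + \frac{3}{4}\left(-\frac{1}{2}C\sigma + \frac{21}{4}\right)k_1 - (C\sigma + 3)^2 > 0, $$ $$ k_2 > k_1 + \frac{9}{4}k_1^2 + \frac{9k_1}{4k_1 - 9/2} + \frac{(k_1^2 - 1)^2}{4}, $$ $$ C > \frac{3}{2\sigma}. $$ Then, with the choice of the state feedback control law $$ u = \bar u(R,\phi,\psi) = (1 - \beta^2 k_1 k_2)\,\phi + \beta^2 k_2\,\psi + 3\beta^2 k_1 R\phi, $$ the origin $(R,\phi,\psi) = (0,0,0)$ is an asymptotically stable equilibrium point of the resulting closed-loop system, with domain of attraction $\mathcal{A} = \{(R,\phi,\psi)\in\mathbb{R}^3 \mid R\ge 0\}$.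
   Context: The system is the three-state Moore-Greitzer model of a jet engine compressor, shifted so that the desired equilibrium is at the origin. Here $R$ is the normalized stall cell squared amplitude, $\phi$ and $\psi$ are the shifted mass flow and plenum pressure rise, and $u = \Phi_T - 1$, where $\Phi_T$ is the mass flow through the throttle. Throughout, the model is considered only for initial conditions with $R(0)\ge 0$, so the state space is $\mathcal{A} = \{(R,\phi,\psi)\in\mathbb{R}^3 \mid R\ge 0\}$. Stability of the origin is understood relative to $\mathcal{A}$: for every neighborhood $U$ of the origin there is a neighborhood $W$ of the origin such that every solution starting in $W\cap\mathcal{A}$ remains in $U\cap\mathcal{A}$ for all $t\ge 0$. "Domain of attraction $\mathcal{A}$" means that every solution starting in $\mathcal{A}$ is defined for all $t\ge 0$, remains in $\mathcal{A}$, and converges to the origin as $t\to\infty$. *)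

theory Defs
  imports "HOL-Analysis.Analysis"
begin

definition forward_interval :: "real set \<Rightarrow> bool" where
  "forward_interval J \<longleftrightarrow> is_interval J \<and> 0 \<in> J \<and> J \<subseteq> {0..}"

text \<open>At an endpoint belonging to \<open>J\<close> the derivative is one-sided; values of \<open>x\<close> outside
  \<open>J\<close> are irrelevant.\<close>

definition solution_on :: "('a::real_normed_vector \<Rightarrow> 'a) \<Rightarrow> real set \<Rightarrow> (real \<Rightarrow> 'a) \<Rightarrow> bool" where
  "solution_on f J x \<longleftrightarrow> forward_interval J \<and>
     (\<forall>t\<in>J. (x has_vector_derivative f (x t)) (at t within J))"

definition maximal_solution :: "('a::real_normed_vector \<Rightarrow> 'a) \<Rightarrow> real set \<Rightarrow> (real \<Rightarrow> 'a) \<Rightarrow> bool" where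
  "maximal_solution f J x \<longleftrightarrow> solution_on f J x \<and>
     (\<forall>J' y. solution_on f J' y \<and> J \<subseteq> J' \<and> (\<forall>t\<in>J. y t = x t) \<longrightarrow> J' = J)"

text \<open>Stability relative to a state space \<open>A\<close>. The vector field is defined on the whole space,
  so that a solution stays in \<open>A\<close> is part of the assertion.\<close>

definition stable_relative :: "('a::real_normed_vector \<Rightarrow> 'a) \<Rightarrow> 'a set \<Rightarrow> 'a \<Rightarrow> bool" where
  "stable_relative f A p \<longleftrightarrow>
     (\<forall>U. open U \<and> p \<in> U \<longrightarrow>
       (\<exists>W. open W \<and> p \<in> W \<and>
         (\<forall>J x. maximal_solution f J x \<and> x 0 \<in> W \<inter> A \<longrightarrow>
            J = {0..} \<and> (\<forall>t\<ge>0. x t \<in> U \<inter> A))))"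

text \<open>The first conjunct rules out that the quantification over solutions is vacuous.\<close>

definition has_domain_of_attraction :: "('a::real_normed_vector \<Rightarrow> 'a) \<Rightarrow> 'a \<Rightarrow> 'a set \<Rightarrow> bool" where
  "has_domain_of_attraction f p A \<longleftrightarrow>
     (\<forall>a\<in>A. \<exists>J x. maximal_solution f J x \<and> x 0 = a) \<and>
     (\<forall>J x. maximal_solution f J x \<and> x 0 \<in> A \<longrightarrow>
        J = {0..} \<and> (\<forall>t\<ge>0. x t \<in> A) \<and> (x \<longlongrightarrow> p) at_top)"

definition asymptotically_stable_equilibrium ::
    "('a::real_normed_vector \<Rightarrow> 'a) \<Rightarrow> 'a \<Rightarrow> 'a set \<Rightarrow> bool" where
  "asymptotically_stable_equilibrium f p A \<longleftrightarrow>
     f p = 0 \<and> stable_relative f A p \<and> has_domain_of_attraction f p A"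

text \<open>States are triples \<open>(R, \<phi>, \<psi>)\<close>.\<close>

type_synonym state = "real \<times> real \<times> real"

definition state_space :: "state set" where
  "state_space = {(R, \<phi>, \<psi>). R \<ge> 0}"

definition moore_greitzer :: "real \<Rightarrow> real \<Rightarrow> real \<Rightarrow> state \<Rightarrow> state" where
  "moore_greitzer \<sigma> \<beta> u = (\<lambda>(R, \<phi>, \<psi>).
     (- \<sigma> * R^2 - \<sigma> * R * (2 * \<phi> + \<phi>^2),
      - \<psi> - 3/2 * \<phi>^2 - 1/2 * \<phi>^3 - 3 * R * \<phi> - 3 * R,
      - (1 / \<beta>^2) * (u - \<phi>)))"

definition feedback :: "real \<Rightarrow> real \<Rightarrow> real \<Rightarrow> state \<Rightarrow> real" where
  "feedback \<beta> k1 k2 = (\<lambda>(R, \<phi>, \<psi>).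
     (1 - \<beta>^2 * k1 * k2) * \<phi> + \<beta>^2 * k2 * \<psi> + 3 * \<beta>^2 * k1 * R * \<phi>)"

definition closed_loop :: "real \<Rightarrow> real \<Rightarrow> real \<Rightarrow> real \<Rightarrow> state \<Rightarrow> state" where
  "closed_loop \<sigma> \<beta> k1 k2 z = moore_greitzer \<sigma> \<beta> (feedback \<beta> k1 k2 z) z"

end

theory Submission imports Defs begin

text \<open>
  Write \<open>e = \<psi> - k1 * \<phi>\<close> for the deviation of the pressure rise from the value that would
  stabilise the mass flow on its own. In the coordinates \<open>(R, \<phi>, e)\<close> the closed loop is
  \<open>R' = - \<sigma> * R * (R + 2 * \<phi> + \<phi>^2)\<close>,
  \<open>\<phi>' = - e - k1 * \<phi> - 3/2 * \<phi>^2 - 1/2 * \<phi>^3 - 3 * R * \<phi> - 3 * R\<close> and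
  \<open>e' = - (k2 - k1) * e + k1^2 * \<phi> + 3/2 * k1 * \<phi>^2 + k1 / 2 * \<phi>^3 + 3 * k1 * R\<close>;
  the term \<open>3 * \<beta>^2 * k1 * R * \<phi>\<close> of the feedback removes \<open>R * \<phi>\<close> from the last equation. The
  Lyapunov function is \<open>V = C * R + \<phi>^2 / 2 + k1 / 8 * \<phi>^4 + e^2 / 2\<close>. It is linear in \<open>R\<close>, which is
  harmless because \<open>R\<close> never becomes negative, and its quartic term is chosen so that the two
  occurrences of \<open>k1 / 2 * e * \<phi>^3\<close> in the derivative of \<open>V\<close> cancel. The remaining mixed terms are
  absorbed by Young's inequality, and the hypotheses on \<open>C\<close>, \<open>k1\<close>, \<open>k2\<close> are exactly what leaves a
  negative multiple of \<open>\<phi>^2\<close>, a negative multiple of \<open>e^2\<close> and a negative definite quadratic form in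
  \<open>(R, \<phi>^2)\<close> (\<open>orbital_derivative_negative\<close>).

  Such a \<open>V\<close> yields the theorem by a version of Lyapunov's global theorem relative to a closed
  forward invariant set (\<open>strict_lyapunov_function.asymptotically_stable\<close>). Its topological part is
  compactness of the sublevel sets. Its analytic part is that solutions exist for all time: the
  vector field is only locally Lipschitz, but \<open>V\<close> confines a solution to a ball fixed in advance, so
  the field may be replaced outside that ball by a globally Lipschitz one, for which Picard
  iteration in an exponentially weighted norm gives a solution on the whole half-line at once
  (\<open>global_solution_of_lipschitz_field\<close>). By uniqueness every maximal solution is this one.
\<close>

section \<open>Global solutions for Lipschitz vector fields\<close>

lemma norm_integral_le_exp:
  fixes g :: "real \<Rightarrow> 'a::banach"
  assumes "continuous_on {0..\<tau>} g" and "\<And>s. s \<in> {0..\<tau>} \<Longrightarrow> norm (g s) \<le> c * exp (l * s)"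
    and "c \<ge> 0" and "l > 0" and "\<tau> \<ge> 0"
  shows "norm (integral {0..\<tau>} g) \<le> c / l * exp (l * \<tau>)"
proof -
  have E: "((\<lambda>s. c * exp (l * s)) has_integral (c / l * exp (l * \<tau>) - c / l * exp (l * 0))) {0..\<tau>}"
    using assms by (intro fundamental_theorem_of_calculus)
      (auto intro!: derivative_eq_intros simp flip: has_real_derivative_iff_has_vector_derivative)
  have "norm (integral {0..\<tau>} g) \<le> integral {0..\<tau>} (\<lambda>s. c * exp (l * s))"
    using assms E by (intro integral_norm_bound_integral integrable_continuous_real continuous_intros) auto
  also have "\<dots> = c / l * exp (l * \<tau>) - c / l"
    using integral_unique[OF E] by simp
  also have "\<dots> \<le> c / l * exp (l * \<tau>)" using assms by simp
  finally show ?thesis .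
qed

lemma integral_has_vector_derivative_ray:
  fixes g :: "real \<Rightarrow> 'a::banach"
  assumes "continuous_on {0..} g" and "t \<ge> 0"
  shows "((\<lambda>u. integral {0..u} g) has_vector_derivative g t) (at t within {0..})"
proof -
  have "continuous_on {0..t+1} g" using assms(1) by (rule continuous_on_subset) auto
  then have "((\<lambda>u. integral {0..u} g) has_vector_derivative g t) (at t within {0..t+1})"
    using assms by (intro integral_has_vector_derivative) auto
  moreover have "at t within {0..t+1} = at t within {0..}"
    by (rule at_within_nhd[of _ "{..<t+1}"]) auto
  ultimately show ?thesis by simp
qed

text \<open>
  The unknown is the rescaled function \<open>z t = exp (- l * t) * y t\<close>, a bounded continuous function.
  In terms of \<open>z\<close> the Picard operator is a contraction for every \<open>l > L\<close>, because integrating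
  \<open>exp (l * s)\<close> gains the factor \<open>1 / l\<close>; so one application of Banach's fixed point theorem gives
  the solution for all times, without continuation from interval to interval.
\<close>

theorem global_solution_of_lipschitz_field:
  fixes F :: "'a::banach \<Rightarrow> 'a"
  assumes lip: "L-lipschitz_on UNIV F"
  obtains y where "y 0 = a" and "solution_on F {0..} y"
proof -
  have L: "L \<ge> 0" using lip by (rule lipschitz_on_nonneg)
  \<comment> \<open>This rate makes the contraction factor at most \<open>1/2\<close>, and it is positive also for \<open>L = 0\<close>.\<close>
  define l where "l = 2 * L + 1"
  have l: "l > 0" "L / l \<le> 1/2" using L by (auto simp: l_def field_simps)
  have contF: "continuous_on S F" for S
    using lipschitz_on_continuous_on[OF lip] continuous_on_subset by blast
  define h where "h z s = F (exp (l * s) *\<^sub>R apply_bcontfun z s)" for z :: "real \<Rightarrow>\<^sub>C 'a" and s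
  have conth: "continuous_on S (h z)" for S z
    unfolding h_def by (intro continuous_on_compose2[OF contF[of UNIV]] continuous_intros) auto
  define P where "P z t = a + integral {0..t} (h z)" for z t
  have derP: "(P z has_vector_derivative h z t) (at t within {0..})" if "t \<ge> 0" for z t
    unfolding P_def using integral_has_vector_derivative_ray[OF conth that, of z]
    by (auto intro!: derivative_eq_intros)
  have contP: "continuous_on {0..} (P z)" for z
    unfolding continuous_on_eq_continuous_within using derP has_vector_derivative_continuous by fastforce
  \<comment> \<open>Freezing time at \<open>0\<close> for negative arguments turns the operator on the half-line into one on
     functions of the whole real line, where the Banach space of bounded continuous functions lives.\<close>
  define Q where "Q z t = exp (- (l * max 0 t)) *\<^sub>R P z (max 0 t)" for z t
  have nh: "norm (h z s) \<le> (norm (F 0) + L * norm z) * exp (l * s)" if "s \<ge> 0" for z s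
  proof -
    have "dist (F (exp (l * s) *\<^sub>R apply_bcontfun z s)) (F 0) \<le> L * dist (exp (l * s) *\<^sub>R apply_bcontfun z s) 0"
      by (rule lipschitz_onD[OF lip UNIV_I UNIV_I])
    then have "norm (h z s - F 0) \<le> L * (exp (l * s) * norm (apply_bcontfun z s))"
      by (simp add: h_def dist_norm)
    also have "\<dots> \<le> L * (exp (l * s) * norm z)"
      using L norm_bounded[of z s] by (intro mult_left_mono) auto
    finally have "norm (h z s) \<le> norm (F 0) + L * (exp (l * s) * norm z)"
      using norm_triangle_ineq2[of "h z s" "F 0"] by linarith
    also have "\<dots> \<le> norm (F 0) * exp (l * s) + L * (exp (l * s) * norm z)"
      using that l by (simp add: mult_le_cancel_left1)
    finally show ?thesis by (simp add: algebra_simps)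
  qed
  have Qb: "Q z \<in> bcontfun" for z
  proof (rule bcontfun_normI)
    show "continuous_on UNIV (Q z)" unfolding Q_def
      by (intro continuous_intros continuous_on_compose2[OF contP[of z]]) auto
    fix t :: real
    define u where "u = max 0 t"
    have u: "u \<ge> 0" by (simp add: u_def)
    have "norm (P z u) \<le> norm a + norm (integral {0..u} (h z))"
      unfolding P_def by (rule norm_triangle_ineq)
    also have "norm (integral {0..u} (h z)) \<le> (norm (F 0) + L * norm z) / l * exp (l * u)"
      using conth nh L l u by (intro norm_integral_le_exp) auto
    also have "norm a \<le> norm a * exp (l * u)" using u l by (simp add: mult_le_cancel_left1)
    finally have "norm (P z u) \<le> (norm a + (norm (F 0) + L * norm z) / l) * exp (l * u)"
      by (simp add: algebra_simps)
    then have "exp (- (l * u)) * norm (P z u)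
        \<le> exp (- (l * u)) * ((norm a + (norm (F 0) + L * norm z) / l) * exp (l * u))"
      by (intro mult_left_mono) auto
    then show "norm (Q z t) \<le> norm a + (norm (F 0) + L * norm z) / l"
      by (simp add: Q_def flip: u_def) (simp add: exp_minus field_simps)
  qed
  have contr: "dist (Bcontfun (Q z)) (Bcontfun (Q w)) \<le> 1/2 * dist z w" for z w
  proof (rule dist_bound)
    fix t :: real
    define u where "u = max 0 t"
    have u: "u \<ge> 0" by (simp add: u_def)
    have hd: "norm (h z s - h w s) \<le> (L * dist z w) * exp (l * s)" for s
    proof -
      have "norm (h z s - h w s) \<le> L * (exp (l * s) * dist (apply_bcontfun z s) (apply_bcontfun w s))"
        using lipschitz_onD[OF lip, of "exp (l * s) *\<^sub>R apply_bcontfun z s" "exp (l * s) *\<^sub>R apply_bcontfun w s"]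
        by (simp add: h_def dist_norm flip: scaleR_diff_right)
      also have "\<dots> \<le> L * (exp (l * s) * dist z w)"
        using L dist_bounded[of z s w] by (intro mult_left_mono) auto
      finally show ?thesis by (simp add: algebra_simps)
    qed
    have "P z u - P w u = integral {0..u} (\<lambda>s. h z s - h w s)"
      unfolding P_def by (simp add: integral_diff integrable_continuous_real conth)
    also have "norm \<dots> \<le> (L * dist z w) / l * exp (l * u)"
      using conth hd L l u by (intro norm_integral_le_exp continuous_intros) auto
    finally have "exp (- (l * u)) * norm (P z u - P w u)
        \<le> exp (- (l * u)) * ((L * dist z w) / l * exp (l * u))"
      by (intro mult_left_mono) auto
    also have "\<dots> = L / l * dist z w" by (simp add: exp_minus field_simps)
    also have "\<dots> \<le> 1/2 * dist z w" using l by (intro mult_right_mono) auto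
    finally show "dist (apply_bcontfun (Bcontfun (Q z)) t) (apply_bcontfun (Bcontfun (Q w)) t) \<le> 1/2 * dist z w"
      by (simp add: Bcontfun_inverse Qb dist_norm Q_def flip: u_def scaleR_diff_right)
  qed
  obtain z where "Bcontfun (Q z) = z"
    using banach_fix_type[of "1/2" "\<lambda>z. Bcontfun (Q z)"] contr by auto
  then have z: "apply_bcontfun z t = Q z t" for t
    using Bcontfun_inverse[OF Qb[of z]] by metis
  have "h z t = F (P z t)" if "t \<ge> 0" for t
    using that by (simp add: h_def z Q_def max_def exp_minus)
  then have "solution_on F {0..} (P z)"
    unfolding solution_on_def forward_interval_def using derP[of _ z] by auto
  moreover have "P z 0 = a" by (simp add: P_def)
  ultimately show ?thesis using that by blast
qed

section \<open>Elementary properties of solutions\<close>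

lemma forward_interval_segment: "forward_interval J \<Longrightarrow> t \<in> J \<Longrightarrow> {0..t} \<subseteq> J"
  by (auto simp: forward_interval_def intro: mem_is_interval_1_I[of J 0 t])

lemma solution_on_subset:
  "solution_on f J x \<Longrightarrow> forward_interval I \<Longrightarrow> I \<subseteq> J \<Longrightarrow> solution_on f I x"
  by (auto simp: solution_on_def intro: has_vector_derivative_within_subset)

lemma solution_on_segment:
  assumes "solution_on f J x" and "t \<in> J"
  shows "solution_on f {0..t} x"
proof -
  have "forward_interval J" using assms by (simp add: solution_on_def)
  then have "{0..t} \<subseteq> J" and "0 \<le> t" using assms(2) forward_interval_segment
    by (auto simp: forward_interval_def)
  then show ?thesis
    using assms(1) by (auto intro!: solution_on_subset[of f J] simp: forward_interval_def)
qed

lemma solution_on_continuous: "solution_on f J x \<Longrightarrow> continuous_on J x"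
  unfolding solution_on_def continuous_on_eq_continuous_within
  by (auto intro: has_vector_derivative_continuous)

lemma decrease_of_derivative_le:
  fixes g :: "real \<Rightarrow> real"
  assumes "a \<le> b"
    and "\<And>s. s \<in> {a..b} \<Longrightarrow> (g has_real_derivative g' s) (at s within {a..b})"
    and "\<And>s. s \<in> {a..b} \<Longrightarrow> g' s \<le> - \<kappa>"
  shows "g b \<le> g a - \<kappa> * (b - a)"
proof -
  obtain s where "s \<in> {a..b}" "g b - g a = g' s * (b - a)"
    using mvt_very_simple[OF assms(1), of g "\<lambda>s. (*) (g' s)"] assms(2)
    by (auto simp: has_field_derivative_def)
  with assms(1,3) have "g b - g a \<le> - \<kappa> * (b - a)" using mult_right_mono[of "g' s" "- \<kappa>" "b - a"] by simp
  then show ?thesis by simp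
qed

lemma derivative_along_solution:
  assumes "solution_on f J x" and "t \<in> J" and "(V has_derivative V') (at (x t))"
  shows "((\<lambda>t. V (x t)) has_real_derivative V' (f (x t))) (at t within J)"
proof -
  have "(x has_derivative (\<lambda>h. h *\<^sub>R f (x t))) (at t within J)"
    using assms by (simp add: solution_on_def has_vector_derivative_def)
  then have "((\<lambda>t. V (x t)) has_derivative (\<lambda>h. V' (h *\<^sub>R f (x t)))) (at t within J)"
    using assms(3) by (rule has_derivative_compose)
  moreover have "V' (h *\<^sub>R f (x t)) = V' (f (x t)) * h" for h
    using linear_cmul[OF has_derivative_linear[OF assms(3)]] by simp
  ultimately show ?thesis by (simp add: has_field_derivative_def fun_eq_iff)
qed

text \<open>
  Gronwall's argument: the squared distance of the two solutions, weighted by \<open>exp (- 2 * L * t)\<close>,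
  is nonincreasing.
\<close>

lemma solution_unique:
  fixes f :: "'a::real_inner \<Rightarrow> 'a"
  assumes x: "solution_on f J x" and y: "solution_on f J y" and "x 0 = y 0"
    and lip: "L-lipschitz_on K f" and K: "x ` J \<subseteq> K" "y ` J \<subseteq> K" and t: "t \<in> J"
  shows "x t = y t"
proof -
  have J: "{0..t} \<subseteq> J" "0 \<le> t"
    using x t forward_interval_segment by (auto simp: solution_on_def forward_interval_def)
  define d where "d s = x s - y s" for s
  define N where "N s = (d s \<bullet> d s) * exp (- 2 * L * s)" for s
  define N' where "N' s = (2 * (d s \<bullet> (f (x s) - f (y s))) - 2 * L * (d s \<bullet> d s)) * exp (- 2 * L * s)" for s
  have "(N has_real_derivative N' s) (at s within {0..t})" if "s \<in> {0..t}" for s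
  proof -
    have d: "(d has_derivative (\<lambda>h. h *\<^sub>R (f (x s) - f (y s)))) (at s within {0..t})"
      unfolding d_def using solution_on_segment[OF x t] solution_on_segment[OF y t] that
      by (auto simp: solution_on_def has_vector_derivative_def scaleR_diff_right
          intro!: has_derivative_diff)
    show ?thesis
      unfolding N_def has_field_derivative_def
      by (rule derivative_eq_intros d refl)+
        (auto simp: N'_def fun_eq_iff inner_commute algebra_simps)
  qed
  moreover have "N' s \<le> - 0" if "s \<in> {0..t}" for s
  proof -
    have s: "x s \<in> K" "y s \<in> K" using K subsetD[OF J(1) that] by auto
    have "d s \<bullet> (f (x s) - f (y s)) \<le> norm (d s) * norm (f (x s) - f (y s))"
      by (rule norm_cauchy_schwarz)
    also have "\<dots> \<le> norm (d s) * (L * norm (d s))"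
      using lipschitz_on_normD[OF lip s] by (intro mult_left_mono) (auto simp: d_def)
    also have "\<dots> = L * (d s \<bullet> d s)" by (simp add: power2_norm_eq_inner flip: power2_eq_square)
    finally show ?thesis by (simp add: N'_def mult_nonpos_nonneg)
  qed
  ultimately have "N t \<le> N 0 - 0 * (t - 0)" by (intro decrease_of_derivative_le) (use J in auto)
  then have "N t \<le> 0" using assms(3) by (simp add: N_def d_def)
  then have "d t \<bullet> d t \<le> 0" by (simp add: N_def mult_le_0_iff)
  then have "d t = 0" by (metis inner_ge_zero inner_eq_zero_iff order_antisym)
  then show ?thesis by (simp add: d_def)
qed

lemma global_solution_maximal:
  assumes "solution_on f {0..} y"
  shows "maximal_solution f {0..} y"
  using assms by (auto simp: maximal_solution_def solution_on_def forward_interval_def)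

text \<open>
  Multiplying \<open>r\<close> by the integrating factor, the exponential of minus the integral of \<open>g\<close>, gives a
  constant function, so \<open>r\<close> keeps the sign of \<open>r 0\<close>.
\<close>

lemma nonneg_of_linear_ode:
  fixes r g :: "real \<Rightarrow> real"
  assumes b: "0 \<le> b" and g: "continuous_on {0..b} g" and r0: "0 \<le> r 0"
    and der: "\<And>t. t \<in> {0..b} \<Longrightarrow> (r has_real_derivative g t * r t) (at t within {0..b})"
  shows "0 \<le> r b"
proof -
  define G where "G t = integral {0..t} g" for t
  have G: "(G has_real_derivative g t) (at t within {0..b})" if "t \<in> {0..b}" for t
    unfolding G_def has_real_derivative_iff_has_vector_derivative
    using g that by (rule integral_has_vector_derivative)
  have "((\<lambda>t. r t * exp (- G t)) has_derivative (\<lambda>h. 0)) (at t within {0..b})" if "t \<in> {0..b}" for t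
  proof -
    have "((\<lambda>t. r t * exp (- G t)) has_real_derivative 0) (at t within {0..b})"
      by (rule derivative_eq_intros der G that refl)+ simp
    moreover have "(*) (0::real) = (\<lambda>h. 0)" by auto
    ultimately show ?thesis by (simp add: has_field_derivative_def)
  qed
  then have "r b * exp (- G b) = r 0 * exp (- G 0)"
    using b by (intro has_derivative_zero_unique[of "{0..b}"]) auto
  then have "r b = r 0 * exp (G b)" by (simp add: G_def exp_minus field_simps)
  with r0 show ?thesis by simp
qed

section \<open>Lyapunov's theorem relative to a forward invariant set\<close>

text \<open>
  The set \<open>A\<close> plays the part of the state space. Invariance is required of every solution on every
  interval because it is used before solutions are known to be global. Boundedness of the sublevel
  sets, which is asked for within \<open>A\<close> only, makes attraction global. The function \<open>V' z\<close> is the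
  derivative of \<open>V\<close> at \<open>z\<close>, so \<open>V' z (f z)\<close> is the derivative of \<open>V\<close> along the orbit through \<open>z\<close>.
\<close>

locale strict_lyapunov_function =
  fixes f :: "'a::euclidean_space \<Rightarrow> 'a" and A :: "'a set" and p :: 'a
    and V :: "'a \<Rightarrow> real" and V' :: "'a \<Rightarrow> 'a \<Rightarrow> real"
  assumes equilibrium: "f p = 0"
    and lipschitz_on_balls: "\<And>r. \<exists>L. L-lipschitz_on (cball p r) f"
    and closed_A: "closed A"
    and invariant: "\<And>J x t. solution_on f J x \<Longrightarrow> x 0 \<in> A \<Longrightarrow> t \<in> J \<Longrightarrow> x t \<in> A"
    and V_deriv: "\<And>z. (V has_derivative V' z) (at z)"
    and orbital_continuous: "continuous_on A (\<lambda>z. V' z (f z))"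
    and V_zero: "V p = 0"
    and V_pos: "\<And>z. z \<in> A \<Longrightarrow> z \<noteq> p \<Longrightarrow> 0 < V z"
    and orbital_neg: "\<And>z. z \<in> A \<Longrightarrow> z \<noteq> p \<Longrightarrow> V' z (f z) < 0"
    and bounded_sublevel: "\<And>c. bounded {z \<in> A. V z \<le> c}"
begin

lemma V_continuous: "continuous_on S V"
  by (intro continuous_at_imp_continuous_on ballI has_derivative_continuous[OF V_deriv])

lemma V_nonneg: "z \<in> A \<Longrightarrow> 0 \<le> V z"
  using V_pos[of z] V_zero by (cases "z = p") auto

lemma orbital_nonpos: "z \<in> A \<Longrightarrow> V' z (f z) \<le> 0"
  using orbital_neg[of z] equilibrium linear_0[OF has_derivative_linear[OF V_deriv]]
  by (cases "z = p") auto

lemma compact_sublevel: "compact {z \<in> A. V z \<le> c}"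
proof -
  have "closed (A \<inter> {z. V z \<le> c})"
    using closed_A closed_Collect_le[OF V_continuous, of "\<lambda>_. c"] by auto
  then show ?thesis using bounded_sublevel[of c] by (auto simp: compact_eq_bounded_closed Collect_conj_eq)
qed

lemma V_decrease:
  assumes x: "solution_on f J x" and "x 0 \<in> A" and "t \<in> J" and "0 \<le> s" and "s \<le> t"
    and rate: "\<And>r. r \<in> {s..t} \<Longrightarrow> V' (x r) (f (x r)) \<le> - \<kappa>"
  shows "V (x t) \<le> V (x s) - \<kappa> * (t - s)"
proof (rule decrease_of_derivative_le[OF \<open>s \<le> t\<close> _ rate])
  fix r assume r: "r \<in> {s..t}"
  have "{s..t} \<subseteq> J"
    using forward_interval_segment[of J t] x assms(3,4) by (auto simp: solution_on_def)
  then show "((\<lambda>t. V (x t)) has_real_derivative V' (x r) (f (x r))) (at r within {s..t})"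
    using DERIV_subset[OF derivative_along_solution[OF x subsetD V_deriv]] r by simp
qed

lemma V_antimono:
  assumes "solution_on f J x" and "x 0 \<in> A" and "t \<in> J" and "0 \<le> s" and "s \<le> t"
  shows "V (x t) \<le> V (x s)"
proof -
  have "V (x t) \<le> V (x s) - 0 * (t - s)"
  proof (rule V_decrease[OF assms])
    fix r assume "r \<in> {s..t}"
    then have "r \<in> J"
      using forward_interval_segment[of J t] assms by (auto simp: solution_on_def)
    then show "V' (x r) (f (x r)) \<le> - 0"
      using orbital_nonpos[OF invariant[OF assms(1,2)]] by simp
  qed
  then show ?thesis by simp
qed

lemma solution_in_sublevel:
  assumes "solution_on f J x" and "x 0 \<in> A" and "t \<in> J"
  shows "x t \<in> {z \<in> A. V z \<le> V (x 0)}"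
proof -
  have "0 \<le> t" using assms(1,3) by (auto simp: solution_on_def forward_interval_def)
  then show ?thesis using V_antimono[OF assms, of 0] invariant[OF assms] by simp
qed

lemma sublevel_in_ball:
  obtains r where "0 < r" and "{z \<in> A. V z \<le> c} \<subseteq> ball p r"
  using bounded_subset_ballD[OF bounded_sublevel] by blast

text \<open>
  Precomposing \<open>f\<close> with the nearest point projection onto a ball gives a globally Lipschitz field,
  which has a global solution \<open>y\<close>. Let the ball be so large that the sublevel set of \<open>a\<close> lies in its
  interior. Up to the first time at which \<open>y\<close> meets the sphere, \<open>y\<close> also solves the original
  equation, hence \<open>V\<close> keeps it in the interior at that very time. So the sphere is never met.
\<close>

lemma global_solution_exists:
  assumes a: "a \<in> A"
  obtains y where "solution_on f {0..} y" and "y 0 = a"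
proof -
  obtain r where r: "0 < r" and sub: "{z \<in> A. V z \<le> V a} \<subseteq> ball p r"
    by (rule sublevel_in_ball)
  obtain L where L: "L-lipschitz_on (cball p r) f" using lipschitz_on_balls by blast
  define c where "c = closest_point (cball p r)"
  have c: "c z \<in> cball p r" "dist (c z) (c w) \<le> dist z w" for z w
    unfolding c_def using r by (auto intro!: closest_point_lipschitz simp del: mem_cball intro: closest_point_in_set)
  have c_self: "c z = z" if "z \<in> cball p r" for z
    unfolding c_def using that by (rule closest_point_self)
  have "L-lipschitz_on UNIV (\<lambda>z. f (c z))"
  proof (rule lipschitz_onI)
    show "0 \<le> L" using L by (rule lipschitz_on_nonneg)
    then show "dist (f (c z)) (f (c w)) \<le> L * dist z w" for z w
      using lipschitz_onD[OF L c(1) c(1), of z w] mult_left_mono[OF c(2), of L z w] by linarith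
  qed
  then obtain y where y0: "y 0 = a" and y: "solution_on (\<lambda>z. f (c z)) {0..} y"
    by (rule global_solution_of_lipschitz_field)
  have dcont: "continuous_on S (\<lambda>t. dist p (y t))" if "S \<subseteq> {0..}" for S
    using continuous_on_subset[OF solution_on_continuous[OF y] that] by (intro continuous_intros)
  have d0: "dist p (y 0) < r" using a y0 sub by auto
  have untruncated: "solution_on f {0..t} y" if "0 \<le> t" "\<And>s. s \<in> {0..t} \<Longrightarrow> dist p (y s) \<le> r" for t
    using solution_on_segment[OF y, of t] that c_self by (auto simp: solution_on_def)
  have stays: "dist p (y t) < r" if t: "0 \<le> t" for t
  proof (rule ccontr)
    assume "\<not> dist p (y t) < r"
    then have "\<exists>u\<ge>0. u \<le> t \<and> dist p (y u) = r"
      using d0 t dcont[of "{0..t}"] by (intro IVT') auto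
    then have ne: "{u \<in> {0..t}. dist p (y u) = r} \<noteq> {}" by auto
    have "closed {u \<in> {0..t}. dist p (y u) = r}"
      by (rule continuous_closed_preimage_constant[OF dcont]) auto
    then have "compact {u \<in> {0..t}. dist p (y u) = r}"
      by (auto simp: compact_eq_bounded_closed intro: bounded_subset[OF bounded_closed_interval[of 0 t]])
    then obtain s where s: "0 \<le> s" "s \<le> t" "dist p (y s) = r"
      and first: "\<And>u. 0 \<le> u \<Longrightarrow> u \<le> t \<Longrightarrow> dist p (y u) = r \<Longrightarrow> s \<le> u"
      using compact_attains_inf[OF _ ne] by auto
    have "dist p (y u) \<le> r" if "u \<in> {0..s}" for u
    proof (rule ccontr)
      assume "\<not> dist p (y u) \<le> r"
      then have "\<exists>v\<ge>0. v \<le> u \<and> dist p (y v) = r"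
        using d0 that dcont[of "{0..u}"] by (intro IVT') auto
      then obtain v where "0 \<le> v" "v \<le> u" "dist p (y v) = r" by blast
      moreover from this have "s \<le> v" using first[of v] that s by auto
      ultimately have "v = u" using that by simp
      with \<open>dist p (y v) = r\<close> \<open>\<not> dist p (y u) \<le> r\<close> show False by simp
    qed
    then have "y s \<in> {z \<in> A. V z \<le> V (y 0)}"
      using s a y0 by (intro solution_in_sublevel[OF untruncated[of s]]) auto
    with sub s y0 show False by auto
  qed
  have "solution_on f {0..} y"
    using y stays c_self by (auto simp: solution_on_def less_imp_le)
  with y0 show ?thesis using that by blast
qed

text \<open>
  On its interval a maximal solution agrees with the global solution from the same point, which
  therefore extends it.
\<close>

lemma maximal_solution_global:
  assumes m: "maximal_solution f J x" and x0: "x 0 \<in> A"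
  shows "J = {0..}"
proof -
  have x: "solution_on f J x" using m by (simp add: maximal_solution_def)
  then have J: "forward_interval J" "J \<subseteq> {0..}" by (auto simp: solution_on_def forward_interval_def)
  obtain y where y: "solution_on f {0..} y" and y0: "y 0 = x 0"
    using global_solution_exists[OF x0] by blast
  obtain r where r: "{z \<in> A. V z \<le> V (x 0)} \<subseteq> ball p r" by (rule sublevel_in_ball)
  obtain L where L: "L-lipschitz_on (cball p r) f" using lipschitz_on_balls by blast
  have yJ: "solution_on f J y" using solution_on_subset[OF y J] .
  have K: "x ` J \<subseteq> cball p r" "y ` J \<subseteq> cball p r"
    using solution_in_sublevel[OF x x0] solution_in_sublevel[OF yJ] x0 y0 r by fastforce+
  have "\<forall>t\<in>J. y t = x t"
    using solution_unique[OF yJ x y0 L K(2) K(1)] by blast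
  with m y J show ?thesis by (auto simp: maximal_solution_def)
qed

text \<open>
  The part of a compact sublevel set outside \<open>U\<close> is compact and avoids \<open>p\<close>, so \<open>V\<close> has a positive
  minimum there. This is what translates smallness of \<open>V\<close> into closeness to \<open>p\<close>, both for stability
  and for convergence.
\<close>

lemma small_value_imp_near:
  assumes "open U" and "p \<in> U"
  shows "\<exists>\<delta>>0. \<forall>z\<in>A. V z < \<delta> \<longrightarrow> z \<in> U"
proof (cases "{z \<in> A. V z \<le> 1} - U = {}")
  case True
  then show ?thesis by (intro exI[of _ 1]) auto
next
  case False
  have "compact ({z \<in> A. V z \<le> 1} - U)" using compact_sublevel assms(1) by (rule compact_diff)
  then obtain w where w: "w \<in> A" "w \<notin> U"
    and min: "\<And>z. z \<in> A \<Longrightarrow> V z \<le> 1 \<Longrightarrow> z \<notin> U \<Longrightarrow> V w \<le> V z"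
    using continuous_attains_inf[OF _ False V_continuous] by auto
  have "0 < V w" using w assms(2) V_pos by metis
  then show ?thesis using min by (intro exI[of _ "min (V w) 1"]) force
qed

lemma stable: "stable_relative f A p"
  unfolding stable_relative_def
proof (intro allI impI, elim conjE)
  fix U assume U: "open U" "p \<in> U"
  then obtain \<delta> where \<delta>: "0 < \<delta>" "\<And>z. z \<in> A \<Longrightarrow> V z < \<delta> \<Longrightarrow> z \<in> U"
    using small_value_imp_near by meson
  show "\<exists>W. open W \<and> p \<in> W \<and> (\<forall>J x. maximal_solution f J x \<and> x 0 \<in> W \<inter> A \<longrightarrow>
      J = {0..} \<and> (\<forall>t\<ge>0. x t \<in> U \<inter> A))"
  proof (intro exI[of _ "{z. V z < \<delta>}"] conjI allI impI)
    show "open {z. V z < \<delta>}" by (intro open_Collect_less V_continuous continuous_intros)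
    show "p \<in> {z. V z < \<delta>}" using \<delta> V_zero by simp
    fix J x assume x: "maximal_solution f J x \<and> x 0 \<in> {z. V z < \<delta>} \<inter> A"
    then show J: "J = {0..}" using maximal_solution_global by blast
    fix t :: real assume "0 \<le> t"
    then have "x t \<in> {z \<in> A. V z \<le> V (x 0)}"
      using x J by (intro solution_in_sublevel[of J]) (auto simp: maximal_solution_def)
    then show "x t \<in> U \<inter> A" using \<delta>(2) x by auto
  qed
qed

text \<open>
  A solution along which \<open>V\<close> stays above \<open>\<epsilon>\<close> would remain in a compact set that avoids \<open>p\<close>. There
  \<open>V\<close> decreases at a rate bounded away from zero, and it would become negative in finite time.
\<close>

lemma V_eventually_small:
  assumes x: "solution_on f {0..} x" and x0: "x 0 \<in> A" and \<epsilon>: "0 < \<epsilon>"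
  shows "\<exists>t\<ge>0. V (x t) < \<epsilon>"
proof (rule ccontr)
  assume "\<not> (\<exists>t\<ge>0. V (x t) < \<epsilon>)"
  then have ge: "\<epsilon> \<le> V (x t)" if "0 \<le> t" for t using that by force
  define S where "S = {z \<in> A. V z \<le> V (x 0)} \<inter> {z. \<epsilon> \<le> V z}"
  have "compact S"
    unfolding S_def
    by (intro compact_Int_closed compact_sublevel closed_Collect_le V_continuous continuous_intros)
  moreover have inS: "x t \<in> S" if "0 \<le> t" for t
    using solution_in_sublevel[OF x x0] ge that by (auto simp: S_def)
  moreover have "continuous_on S (\<lambda>z. V' z (f z))"
    using orbital_continuous by (rule continuous_on_subset) (auto simp: S_def)
  ultimately obtain w where w: "w \<in> S" and max: "\<And>z. z \<in> S \<Longrightarrow> V' z (f z) \<le> V' w (f w)"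
    using continuous_attains_sup[of S "\<lambda>z. V' z (f z)"] by force
  define \<kappa> where "\<kappa> = - V' w (f w)"
  have "w \<in> A" "w \<noteq> p" using w V_zero \<epsilon> by (auto simp: S_def)
  then have \<kappa>: "0 < \<kappa>" using orbital_neg by (simp add: \<kappa>_def)
  \<comment> \<open>By this time the guaranteed decrease has used up the initial value.\<close>
  define T where "T = V (x 0) / \<kappa>"
  have T: "0 \<le> T" "\<kappa> * T = V (x 0)" using \<kappa> V_nonneg[OF x0] by (auto simp: T_def)
  have "V (x T) \<le> V (x 0) - \<kappa> * (T - 0)"
    using T max[OF inS] by (intro V_decrease[OF x x0]) (auto simp: \<kappa>_def)
  with ge[OF T(1)] T \<epsilon> show False by simp
qed

lemma attractive: "has_domain_of_attraction f p A"
  unfolding has_domain_of_attraction_def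
proof (intro conjI ballI allI impI)
  fix a assume "a \<in> A"
  then show "\<exists>J x. maximal_solution f J x \<and> x 0 = a"
    using global_solution_exists global_solution_maximal by metis
next
  fix J x assume m: "maximal_solution f J x \<and> x 0 \<in> A"
  then show J: "J = {0..}" using maximal_solution_global by blast
  then have x: "solution_on f {0..} x" and x0: "x 0 \<in> A" using m by (auto simp: maximal_solution_def)
  show "x t \<in> A" if "0 \<le> t" for t using invariant[OF x x0] that by simp
  show "(x \<longlongrightarrow> p) at_top"
  proof (rule topological_tendstoI)
    fix U assume "open U" "p \<in> U"
    then obtain \<delta> where \<delta>: "0 < \<delta>" "\<And>z. z \<in> A \<Longrightarrow> V z < \<delta> \<Longrightarrow> z \<in> U"
      using small_value_imp_near by meson
    obtain s where s: "0 \<le> s" "V (x s) < \<delta>" using V_eventually_small[OF x x0 \<delta>(1)] by blast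
    have "x t \<in> U" if "s \<le> t" for t
      using V_antimono[OF x x0, of t s] invariant[OF x x0, of t] \<delta>(2) s that by force
    then show "\<forall>\<^sub>F t in at_top. x t \<in> U" unfolding eventually_at_top_linorder by blast
  qed
qed

theorem asymptotically_stable: "asymptotically_stable_equilibrium f p A"
  using equilibrium stable attractive by (simp add: asymptotically_stable_equilibrium_def)

end

section \<open>Lipschitz continuity of polynomial maps on bounded sets\<close>

text \<open>
  Leaving the constant open makes Lipschitz continuity compositional: polynomial maps can be
  treated by introduction rules alone.
\<close>

definition is_lipschitz_on :: "'a::metric_space set \<Rightarrow> ('a \<Rightarrow> 'b::metric_space) \<Rightarrow> bool" where
  "is_lipschitz_on S g \<longleftrightarrow> (\<exists>L. L-lipschitz_on S g)"

lemma is_lipschitz_on_mult: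
  fixes g h :: "'a::metric_space \<Rightarrow> real"
  assumes S: "bounded S" and "is_lipschitz_on S g" and "is_lipschitz_on S h"
  shows "is_lipschitz_on S (\<lambda>z. g z * h z)"
proof -
  have bound: "\<exists>B\<ge>0. \<forall>z\<in>S. \<bar>k z\<bar> \<le> B" if k: "K-lipschitz_on S k" for K and k :: "'a \<Rightarrow> real"
  proof -
    obtain D where D: "\<And>z w. z \<in> S \<Longrightarrow> w \<in> S \<Longrightarrow> dist z w \<le> D"
      using S unfolding bounded_two_points by blast
    show ?thesis
    proof (cases "S = {}")
      case False
      then obtain w where w: "w \<in> S" by blast
      have "\<bar>k z\<bar> \<le> \<bar>k w\<bar> + K * D" if "z \<in> S" for z
        using lipschitz_onD[OF k that w] mult_left_mono[OF D[OF that w] lipschitz_on_nonneg[OF k]]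
        by (simp add: dist_real_def)
      then show ?thesis using w by (meson abs_ge_zero order_trans)
    qed auto
  qed
  obtain G H where G: "G-lipschitz_on S g" and H: "H-lipschitz_on S h"
    using assms by (auto simp: is_lipschitz_on_def)
  obtain B where B: "B \<ge> 0" "\<And>z. z \<in> S \<Longrightarrow> \<bar>g z\<bar> \<le> B" using bound[OF G] by blast
  obtain D where D: "D \<ge> 0" "\<And>z. z \<in> S \<Longrightarrow> \<bar>h z\<bar> \<le> D" using bound[OF H] by blast
  note nonneg = lipschitz_on_nonneg[OF G] lipschitz_on_nonneg[OF H]
  have "(B * H + D * G)-lipschitz_on S (\<lambda>z. g z * h z)"
  proof (rule lipschitz_onI)
    fix z w assume zw: "z \<in> S" "w \<in> S"
    have "\<bar>g z * h z - g w * h w\<bar> = \<bar>g z * (h z - h w) + h w * (g z - g w)\<bar>"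
      by (simp add: algebra_simps)
    also have "\<dots> \<le> \<bar>g z\<bar> * \<bar>h z - h w\<bar> + \<bar>h w\<bar> * \<bar>g z - g w\<bar>"
      by (metis abs_mult abs_triangle_ineq)
    also have "\<dots> \<le> B * (H * dist z w) + D * (G * dist z w)"
      using lipschitz_onD[OF G zw] lipschitz_onD[OF H zw] B D zw nonneg
      by (intro add_mono mult_mono) (auto simp: dist_real_def)
    finally show "dist (g z * h z) (g w * h w) \<le> (B * H + D * G) * dist z w"
      by (simp add: dist_real_def algebra_simps)
  qed (use B D nonneg in auto)
  then show ?thesis by (auto simp: is_lipschitz_on_def)
qed

lemma is_lipschitz_on_const: "is_lipschitz_on S (\<lambda>z. c)"
  unfolding is_lipschitz_on_def using lipschitz_on_constant by blast

lemma is_lipschitz_on_diff: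
  fixes g h :: "'a::metric_space \<Rightarrow> 'b::real_normed_vector"
  shows "is_lipschitz_on S g \<Longrightarrow> is_lipschitz_on S h \<Longrightarrow> is_lipschitz_on S (\<lambda>z. g z - h z)"
  unfolding is_lipschitz_on_def using lipschitz_on_diff by blast

lemma is_lipschitz_on_add:
  fixes g h :: "'a::metric_space \<Rightarrow> 'b::real_normed_vector"
  shows "is_lipschitz_on S g \<Longrightarrow> is_lipschitz_on S h \<Longrightarrow> is_lipschitz_on S (\<lambda>z. g z + h z)"
  unfolding is_lipschitz_on_def using lipschitz_on_add by blast

lemma is_lipschitz_on_Pair:
  "is_lipschitz_on S g \<Longrightarrow> is_lipschitz_on S h \<Longrightarrow> is_lipschitz_on S (\<lambda>z. (g z, h z))"
  unfolding is_lipschitz_on_def using lipschitz_on_Pair by blast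

lemma is_lipschitz_on_bounded_linear: "bounded_linear g \<Longrightarrow> is_lipschitz_on S g"
  unfolding is_lipschitz_on_def using bounded_linear.lipschitz_boundE by blast

section \<open>The Moore-Greitzer closed loop\<close>

text \<open>
  The coupling term \<open>\<phi>\<close> and the factor \<open>1 / \<beta>^2\<close> of the pressure equation are both cancelled by the
  feedback.
\<close>

lemma closed_loop_explicit:
  assumes "\<beta> \<noteq> 0"
  shows "closed_loop \<sigma> \<beta> k1 k2 (R, \<phi>, \<psi>) =
    (- \<sigma> * R^2 - \<sigma> * R * (2 * \<phi> + \<phi>^2),
     - \<psi> - 3/2 * \<phi>^2 - 1/2 * \<phi>^3 - 3 * R * \<phi> - 3 * R,
     k1 * k2 * \<phi> - k2 * \<psi> - 3 * k1 * R * \<phi>)"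
  using assms by (simp add: closed_loop_def moore_greitzer_def feedback_def field_simps)

lemma closed_loop_lipschitz_on_bounded:
  assumes "bounded S" and "\<beta> \<noteq> 0"
  shows "\<exists>L. L-lipschitz_on S (closed_loop \<sigma> \<beta> k1 k2)"
proof -
  \<comment> \<open>The right-hand side is built from constants, projections, sums, differences and products only,
     which is what the introduction rules cover.\<close>
  have "closed_loop \<sigma> \<beta> k1 k2 = (\<lambda>z.
    ((- \<sigma>) * (fst z * fst z) - \<sigma> * (fst z * (2 * fst (snd z) + fst (snd z) * fst (snd z))),
     0 - snd (snd z) - 3/2 * (fst (snd z) * fst (snd z))
       - 1/2 * (fst (snd z) * (fst (snd z) * fst (snd z))) - 3 * (fst z * fst (snd z)) - 3 * fst z,
     k1 * k2 * fst (snd z) - k2 * snd (snd z) - 3 * k1 * (fst z * fst (snd z))))"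
    using assms by (auto simp: closed_loop_explicit power2_eq_square power3_eq_cube)
  moreover have "is_lipschitz_on S \<dots>"
    by (intro is_lipschitz_on_Pair is_lipschitz_on_diff is_lipschitz_on_add
        is_lipschitz_on_mult[OF assms(1)] is_lipschitz_on_const is_lipschitz_on_bounded_linear)
      (auto intro!: bounded_linear_intros)
  ultimately show ?thesis by (simp add: is_lipschitz_on_def)
qed

text \<open>
  The first equation has the form \<open>R' = g * R\<close> along a solution, so \<open>R\<close> cannot change sign.
\<close>

lemma state_space_invariant:
  assumes x: "solution_on (closed_loop \<sigma> \<beta> k1 k2) J x" and x0: "x 0 \<in> state_space" and t: "t \<in> J"
  shows "x t \<in> state_space"
proof -
  define R \<phi> where "R s = fst (x s)" and "\<phi> s = fst (snd (x s))" for s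
  have x': "solution_on (closed_loop \<sigma> \<beta> k1 k2) {0..t} x"
    using x t by (rule solution_on_segment)
  note cont = solution_on_continuous[OF x']
  have "0 \<le> R t"
  proof (rule nonneg_of_linear_ode[where r = R and b = t and g = "\<lambda>s. - \<sigma> * (R s + 2 * \<phi> s + (\<phi> s)^2)"])
    show "continuous_on {0..t} (\<lambda>s. - \<sigma> * (R s + 2 * \<phi> s + (\<phi> s)^2))"
      unfolding R_def \<phi>_def by (intro continuous_intros cont)
    show "(R has_real_derivative - \<sigma> * (R s + 2 * \<phi> s + (\<phi> s)^2) * R s) (at s within {0..t})"
      if "s \<in> {0..t}" for s
    proof -
      have "(R has_real_derivative fst (closed_loop \<sigma> \<beta> k1 k2 (x s))) (at s within {0..t})"
        unfolding R_def
        by (rule derivative_along_solution[OF x' that, where V = fst and V' = fst])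
          (rule has_derivative_fst[OF has_derivative_ident])
      moreover have "fst (closed_loop \<sigma> \<beta> k1 k2 (x s)) = - \<sigma> * (R s + 2 * \<phi> s + (\<phi> s)^2) * R s"
        by (simp add: closed_loop_def moore_greitzer_def R_def \<phi>_def case_prod_beta power2_eq_square algebra_simps)
      ultimately show ?thesis by simp
    qed
  qed (use x0 x t in \<open>auto simp: state_space_def R_def case_prod_beta solution_on_def forward_interval_def\<close>)
  then show ?thesis by (simp add: state_space_def R_def case_prod_beta)
qed

definition mg_lyapunov :: "real \<Rightarrow> real \<Rightarrow> state \<Rightarrow> real" where
  "mg_lyapunov C k1 = (\<lambda>(R, \<phi>, \<psi>). C * R + \<phi>^2 / 2 + k1 / 8 * \<phi>^4 + (\<psi> - k1 * \<phi>)^2 / 2)"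

definition mg_lyapunov_deriv :: "real \<Rightarrow> real \<Rightarrow> state \<Rightarrow> state \<Rightarrow> real" where
  "mg_lyapunov_deriv C k1 = (\<lambda>(R, \<phi>, \<psi>) (a, b, c).
     C * a + (\<phi> + k1 / 2 * \<phi>^3) * b + (\<psi> - k1 * \<phi>) * (c - k1 * b))"

lemma mg_lyapunov_has_derivative:
  "(mg_lyapunov C k1 has_derivative mg_lyapunov_deriv C k1 z) (at z)"
proof -
  have "((\<lambda>z. C * fst z + fst (snd z)^2 / 2 + k1 / 8 * fst (snd z)^4 + (snd (snd z) - k1 * fst (snd z))^2 / 2)
    has_derivative mg_lyapunov_deriv C k1 z) (at z)"
    by (auto intro!: derivative_eq_intros
        simp: mg_lyapunov_deriv_def fun_eq_iff case_prod_beta field_simps power3_eq_cube)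
  moreover have "mg_lyapunov C k1 = (\<lambda>z. C * fst z + fst (snd z)^2 / 2 + k1 / 8 * fst (snd z)^4
      + (snd (snd z) - k1 * fst (snd z))^2 / 2)"
    by (simp add: mg_lyapunov_def fun_eq_iff)
  ultimately show ?thesis by simp
qed

text \<open>
  The left-hand side is the derivative of the Lyapunov function along the closed loop in the
  coordinates \<open>(R, \<phi>, e)\<close>. The terms \<open>k1 / 2 * e * \<phi>^3\<close> cancel. Each hypothesis pays for certain
  mixed terms:
  the one on \<open>k1\<close> lets \<open>k1 * \<phi>^2\<close> dominate the shares of \<open>\<phi>^2\<close> that come from
  \<open>(2 * C * \<sigma> + 3) * R * \<phi>\<close>, from the cubic term (\<open>9/8\<close>) and from \<open>(k1^2 - 1) * e * \<phi>\<close> (\<open>1\<close>);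
  the three last summands of the bound on \<open>k2\<close> are the shares of \<open>e^2\<close>
  in the products of \<open>e\<close> with \<open>R\<close>, \<open>\<phi>^2\<close> and \<open>\<phi>\<close>;
  \<open>C * \<sigma> > 3/2\<close> leaves a positive coefficient of \<open>R^2\<close> after the shares \<open>1/2\<close> and \<open>1\<close>;
  and the quadratic inequality in \<open>k1\<close> is \<open>4 * a * d - b^2 > 0\<close>, definiteness of the remaining
  form \<open>a * R^2 - b * R * \<phi>^2 + d * \<phi>^4\<close>.
\<close>

lemma orbital_derivative_negative:
  fixes C \<sigma> k1 k2 R \<phi> e :: real
  assumes k1: "k1 > 17/8 + (2 * C * \<sigma> + 3)^2 / 2"
    and quad: "(C * \<sigma> - 105/64) * k1^2 + 3/4 * (- (1/2) * C * \<sigma> + 21/4) * k1 - (C * \<sigma> + 3)^2 > 0"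
    and k2: "k2 > k1 + 9/4 * k1^2 + 9 * k1 / (4 * k1 - 9/2) + (k1^2 - 1)^2 / 4"
    and C: "C * \<sigma> > 3 / 2"
    and R: "R \<ge> 0" and nz: "R \<noteq> 0 \<or> \<phi> \<noteq> 0 \<or> e \<noteq> 0"
  shows "C * (- \<sigma> * R^2 - \<sigma> * R * (2 * \<phi> + \<phi>^2))
    + (\<phi> + k1 / 2 * \<phi>^3) * (- e - k1 * \<phi> - 3/2 * \<phi>^2 - 1/2 * \<phi>^3 - 3 * R * \<phi> - 3 * R)
    + e * (- (k2 - k1) * e + k1^2 * \<phi> + 3/2 * k1 * \<phi>^2 + k1 / 2 * \<phi>^3 + 3 * k1 * R) < 0" (is "?D < 0")
proof -
  define D where "D = C * \<sigma>"
  define q where "q = 9 * k1 / (4 * k1 - 9/2)"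
  have kpos: "k1 > 17/8" using k1 zero_le_power2[of "2 * C * \<sigma> + 3"] by linarith
  \<comment> \<open>What survives in the end is \<open>- m1 * \<phi>^2 - m2 * e^2 - (a * R^2 - b * R * \<phi>^2 + d * \<phi>^4)\<close>.\<close>
  define m1 where "m1 = k1 - 17/8 - (2 * D + 3)^2 / 2"
  define m2 where "m2 = k2 - k1 - 9/4 * k1^2 - q - (k1^2 - 1)^2 / 4"
  define a where "a = D - 3/2"
  define d where "d = k1 * (k1 - 9/8) / 4"
  define b where "b = 3 * k1 / 8 - D - 3"
  have m: "m1 > 0" "m2 > 0" using k1 k2 by (simp_all add: m1_def m2_def q_def D_def algebra_simps)
  have ad: "a > 0" "d > 0" using C kpos by (simp_all add: a_def d_def D_def)
  have disc: "4 * a * d - b^2 > 0"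
  proof -
    have "4 * a * d - b^2 = (C * \<sigma> - 105/64) * k1^2 + 3/4 * (- (1/2) * C * \<sigma> + 21/4) * k1 - (C * \<sigma> + 3)^2"
      by (simp add: a_def d_def b_def D_def field_simps power2_eq_square)
    then show ?thesis using quad by simp
  qed
  \<comment> \<open>This identity is what fixes the fraction \<open>q\<close> in the hypothesis on \<open>k2\<close>: it makes the form in \<open>s5\<close> a perfect square.\<close>
  have qd: "q * d = 9/16 * k1^2"
    using kpos by (simp add: q_def d_def field_simps power2_eq_square)
  have q: "q > 0" using kpos by (simp add: q_def)
  have s1: "- ((2 * D + 3) * R * \<phi>) \<le> (2 * D + 3)^2 / 2 * \<phi>^2 + R^2 / 2"
  proof -
    have "0 \<le> ((2 * D + 3) * \<phi> + R)^2 / 2" by simp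
    also have "\<dots> = (2 * D + 3)^2 / 2 * \<phi>^2 + R^2 / 2 + (2 * D + 3) * R * \<phi>"
      by (simp add: power2_eq_square field_simps)
    finally show ?thesis by linarith
  qed
  have s2: "- 3/2 * \<phi>^3 \<le> 9/8 * \<phi>^2 + 1/2 * \<phi>^4"
    using zero_le_power2[of "\<phi> * (\<phi> + 3/2)"] by (simp add: power2_eq_square power3_eq_cube power4_eq_xxxx algebra_simps)
  have s3: "(k1^2 - 1) * e * \<phi> \<le> (k1^2 - 1)^2 / 4 * e^2 + \<phi>^2"
    using zero_le_power2[of "(k1^2 - 1) * e / 2 - \<phi>"] by (simp add: power2_eq_square algebra_simps)
  have s4: "3 * k1 * R * e \<le> 9/4 * k1^2 * e^2 + R^2"
    using zero_le_power2[of "3/2 * k1 * e - R"] by (simp add: power2_eq_square algebra_simps)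
  have s5: "3/2 * k1 * \<phi>^2 * e \<le> q * e^2 + d * \<phi>^4"
  proof -
    have "4 * q * (q * e^2 + d * \<phi>^4 - 3/2 * k1 * \<phi>^2 * e) = (2 * q * e - 3/2 * k1 * \<phi>^2)^2 + 4 * (q * d - 9/16 * k1^2) * \<phi>^4"
      by (simp add: power2_eq_square power4_eq_xxxx algebra_simps)
    also have "\<dots> \<ge> 0" using qd by simp
    finally show ?thesis using q by (simp add: zero_le_mult_iff)
  qed
  \<comment> \<open>Completing the square in \<open>k1 + 3/2 * \<phi> + 1/2 * \<phi>^2\<close> leaves \<open>2 * d\<close>, one half of which pays for \<open>s5\<close>.\<close>
  have s6: "- (k1 / 2 * (k1 * \<phi>^4 + 3/2 * \<phi>^5 + 1/2 * \<phi>^6)) \<le> - 2 * d * \<phi>^4"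
  proof -
    have "0 \<le> k1 / 4 * (\<phi>^2 * (\<phi> + 3/2))^2" using kpos by simp
    also have "\<dots> = k1 / 2 * (k1 * \<phi>^4 + 3/2 * \<phi>^5 + 1/2 * \<phi>^6) - 2 * d * \<phi>^4"
      by (simp add: d_def power2_eq_square field_simps eval_nat_numeral)
    finally show ?thesis by simp
  qed
  \<comment> \<open>Here \<open>R \<ge> 0\<close> is essential, together with \<open>\<phi>^2 + \<phi> \<ge> - 1/4\<close>.\<close>
  have s7: "- (3/2 * k1 * R * (\<phi>^3 + \<phi>^4)) \<le> 3/8 * k1 * R * \<phi>^2"
  proof -
    have "0 \<le> 3/2 * k1 * R * (\<phi> * (\<phi> + 1/2))^2" using kpos R by simp
    also have "\<dots> = 3/2 * k1 * R * (\<phi>^3 + \<phi>^4) + 3/8 * k1 * R * \<phi>^2"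
      by (simp add: eval_nat_numeral algebra_simps)
    finally show ?thesis by linarith
  qed
  define Q where "Q = a * R^2 - b * R * \<phi>^2 + d * \<phi>^4"
  have Q4: "4 * d * Q = (2 * d * \<phi>^2 - b * R)^2 + (4 * a * d - b^2) * R^2"
    by (simp add: Q_def power2_eq_square power4_eq_xxxx algebra_simps)
  have Qpos: "Q \<ge> 0" "R \<noteq> 0 \<Longrightarrow> Q > 0"
  proof -
    have "0 \<le> 4 * d * Q" unfolding Q4 using disc by simp
    then show "Q \<ge> 0" using ad by (simp add: zero_le_mult_iff)
    assume "R \<noteq> 0"
    then have "0 < 4 * d * Q" unfolding Q4 using disc by (intro add_nonneg_pos) simp_all
    then show "Q > 0" using ad by (simp add: zero_less_mult_iff)
  qed
  have "?D = - D * R^2 - (2 * D + 3) * R * \<phi> - (D + 3) * R * \<phi>^2 - k1 * \<phi>^2 - 3/2 * \<phi>^3 - 1/2 * \<phi>^4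
     - k1 / 2 * (k1 * \<phi>^4 + 3/2 * \<phi>^5 + 1/2 * \<phi>^6) - 3/2 * k1 * R * (\<phi>^3 + \<phi>^4)
     - (k2 - k1) * e^2 + (k1^2 - 1) * e * \<phi> + 3/2 * k1 * \<phi>^2 * e + 3 * k1 * R * e"
    by (simp add: D_def eval_nat_numeral algebra_simps)
  also have "\<dots> \<le> - D * R^2 + ((2 * D + 3)^2 / 2 * \<phi>^2 + R^2 / 2) - (D + 3) * R * \<phi>^2 - k1 * \<phi>^2 + 9/8 * \<phi>^2
     - 2 * d * \<phi>^4 + 3/8 * k1 * R * \<phi>^2
     - (k2 - k1) * e^2 + ((k1^2 - 1)^2 / 4 * e^2 + \<phi>^2) + (q * e^2 + d * \<phi>^4) + (9/4 * k1^2 * e^2 + R^2)"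
    using s1 s2 s3 s4 s5 s6 s7 by linarith
  also have "\<dots> = - m1 * \<phi>^2 - m2 * e^2 - Q"
    by (simp add: m1_def m2_def Q_def a_def b_def field_simps)
  also have "\<dots> < 0"
  proof -
    have "m1 * \<phi>^2 \<ge> 0" "m2 * e^2 \<ge> 0" using m by simp_all
    moreover have "\<phi> \<noteq> 0 \<Longrightarrow> m1 * \<phi>^2 > 0" "e \<noteq> 0 \<Longrightarrow> m2 * e^2 > 0" using m by simp_all
    ultimately show ?thesis using nz Qpos by fastforce
  qed
  finally show ?thesis .
qed

lemma mg_sublevel_bounded:
  assumes "C > 0" and "k1 > 0"
  shows "bounded {z \<in> state_space. mg_lyapunov C k1 z \<le> c}"
proof -
  define B where "B = \<bar>c\<bar> / C + (2 * \<bar>c\<bar> + 1) + ((2 * \<bar>c\<bar> + 1) + k1 * (2 * \<bar>c\<bar> + 1))"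
  have sq: "\<bar>s\<bar> \<le> 2 * \<bar>c\<bar> + 1" if "s^2 \<le> 2 * \<bar>c\<bar>" for s :: real
  proof -
    have "2 * \<bar>s\<bar> \<le> s^2 + 1" using zero_le_power2[of "\<bar>s\<bar> - 1"] by (simp add: power2_eq_square algebra_simps)
    then show ?thesis using that by linarith
  qed
  have "norm z \<le> B" if "z \<in> state_space" "mg_lyapunov C k1 z \<le> c" for z
  proof -
    obtain R \<phi> \<psi> where z: "z = (R, \<phi>, \<psi>)" by (cases z)
    have V: "C * R + \<phi>^2 / 2 + k1 / 8 * \<phi>^4 + (\<psi> - k1 * \<phi>)^2 / 2 \<le> c" and R: "0 \<le> R"
      using that by (auto simp: z mg_lyapunov_def state_space_def)
    have nn: "0 \<le> C * R" "0 \<le> \<phi>^2" "0 \<le> k1 / 8 * \<phi>^4" "0 \<le> (\<psi> - k1 * \<phi>)^2" using assms R by simp_all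
    have "C * R \<le> \<bar>c\<bar>" using V nn by linarith
    then have 1: "\<bar>R\<bar> \<le> \<bar>c\<bar> / C" using assms R by (simp add: field_simps)
    have 2: "\<bar>\<phi>\<bar> \<le> 2 * \<bar>c\<bar> + 1" using V nn by (intro sq) linarith
    have "\<bar>\<psi> - k1 * \<phi>\<bar> \<le> 2 * \<bar>c\<bar> + 1" using V nn by (intro sq) linarith
    moreover have "\<bar>k1 * \<phi>\<bar> \<le> k1 * (2 * \<bar>c\<bar> + 1)" using 2 assms by (simp add: abs_mult)
    ultimately have 3: "\<bar>\<psi>\<bar> \<le> (2 * \<bar>c\<bar> + 1) + k1 * (2 * \<bar>c\<bar> + 1)" by linarith
    have "norm z \<le> \<bar>R\<bar> + (\<bar>\<phi>\<bar> + \<bar>\<psi>\<bar>)"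
      using norm_Pair_le[of R "(\<phi>, \<psi>)"] norm_Pair_le[of \<phi> \<psi>] by (simp add: z)
    then show ?thesis using 1 2 3 by (simp add: B_def)
  qed
  then show ?thesis by (intro boundedI) auto
qed

lemma mg_lyapunov_positive:
  assumes "z \<in> state_space" and "z \<noteq> (0, 0, 0)" and "C > 0" and "k1 > 0"
  shows "0 < mg_lyapunov C k1 z"
proof -
  obtain R \<phi> \<psi> where z: "z = (R, \<phi>, \<psi>)" by (cases z)
  have R: "R \<ge> 0" using assms(1) by (simp add: z state_space_def)
  have nn: "0 \<le> C * R" "0 \<le> \<phi>^2" "0 \<le> k1 / 8 * \<phi>^4" "0 \<le> (\<psi> - k1 * \<phi>)^2"
    using assms R by simp_all
  have "R \<noteq> 0 \<or> \<phi> \<noteq> 0 \<or> \<psi> - k1 * \<phi> \<noteq> 0" using assms(2) by (auto simp: z)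
  then have "0 < C * R \<or> 0 < \<phi>^2 \<or> 0 < (\<psi> - k1 * \<phi>)^2"
    using R assms(3) by (auto simp: zero_less_mult_iff)
  with nn show ?thesis unfolding z mg_lyapunov_def prod.case by linarith
qed

theorem theorem1:
  fixes \<sigma> \<beta> C k1 k2 :: real
  assumes "\<sigma> = 7" and "\<beta> = 1 / sqrt 2"
    and "k1 > 0" and "k2 > 0"
    and "k1 > 17/8 + (2 * C * \<sigma> + 3)^2 / 2"
    and "(C * \<sigma> - 105/64) * k1^2 + 3/4 * (- (1/2) * C * \<sigma> + 21/4) * k1 - (C * \<sigma> + 3)^2 > 0"
    and "k2 > k1 + 9/4 * k1^2 + 9 * k1 / (4 * k1 - 9/2) + (k1^2 - 1)^2 / 4"
    and "C > 3 / (2 * \<sigma>)"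
  shows "asymptotically_stable_equilibrium (closed_loop \<sigma> \<beta> k1 k2) (0, 0, 0) state_space"
proof -
  let ?f = "closed_loop \<sigma> \<beta> k1 k2"
  let ?O = "\<lambda>z. mg_lyapunov_deriv C k1 z (?f z)"
  have \<beta>: "\<beta> \<noteq> 0" using assms(2) by simp
  have C: "C > 0" "C * \<sigma> > 3/2" using assms(1,8) by simp_all
  note f = closed_loop_explicit[OF \<beta>]
  have explicit: "?O (R, \<phi>, \<psi>) =
      C * (- \<sigma> * R^2 - \<sigma> * R * (2 * \<phi> + \<phi>^2))
      + (\<phi> + k1 / 2 * \<phi>^3) * (- e - k1 * \<phi> - 3/2 * \<phi>^2 - 1/2 * \<phi>^3 - 3 * R * \<phi> - 3 * R)
      + e * (- (k2 - k1) * e + k1^2 * \<phi> + 3/2 * k1 * \<phi>^2 + k1 / 2 * \<phi>^3 + 3 * k1 * R)"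
    if e: "e = \<psi> - k1 * \<phi>" for R \<phi> \<psi> e
    by (simp add: e f mg_lyapunov_deriv_def field_simps power2_eq_square power3_eq_cube)
  interpret strict_lyapunov_function ?f state_space "(0, 0, 0)" "mg_lyapunov C k1" "mg_lyapunov_deriv C k1"
  proof
    show "?f (0, 0, 0) = 0" by (simp add: f zero_prod_def)
    show "\<exists>L. L-lipschitz_on (cball (0, 0, 0) r) ?f" for r
      by (rule closed_loop_lipschitz_on_bounded[OF bounded_cball \<beta>])
    have "closed {z::state. 0 \<le> fst z}" by (intro closed_Collect_le continuous_intros)
    moreover have "{z::state. 0 \<le> fst z} = state_space" by (auto simp: state_space_def)
    ultimately show "closed state_space" by simp
    show "x t \<in> state_space" if "solution_on ?f J x" "x 0 \<in> state_space" "t \<in> J" for J x t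
      using that by (rule state_space_invariant)
    show "(mg_lyapunov C k1 has_derivative mg_lyapunov_deriv C k1 z) (at z)" for z
      by (rule mg_lyapunov_has_derivative)
    have "continuous_on state_space (\<lambda>z. ?O (fst z, fst (snd z), snd (snd z)))"
      unfolding explicit[OF refl] by (intro continuous_intros)
    then show "continuous_on state_space ?O" by simp
    show "mg_lyapunov C k1 (0, 0, 0) = 0" by (simp add: mg_lyapunov_def)
    show "0 < mg_lyapunov C k1 z" if "z \<in> state_space" "z \<noteq> (0, 0, 0)" for z
      using that C(1) assms(3) by (rule mg_lyapunov_positive)
    show "?O z < 0" if "z \<in> state_space" "z \<noteq> (0, 0, 0)" for z
    proof -
      obtain R \<phi> \<psi> where z: "z = (R, \<phi>, \<psi>)" by (cases z)
      have "R \<ge> 0" "R \<noteq> 0 \<or> \<phi> \<noteq> 0 \<or> \<psi> - k1 * \<phi> \<noteq> 0"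
        using that by (auto simp: z state_space_def)
      then show ?thesis
        unfolding z explicit[OF refl] by (rule orbital_derivative_negative[OF assms(5-7) C(2)])
    qed
    show "bounded {z \<in> state_space. mg_lyapunov C k1 z \<le> c}" for c
      using C(1) assms(3) by (rule mg_sublevel_bounded)
  qed
  show ?thesis by (rule asymptotically_stable)
qed

end
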